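(* For every integer $k$ with $6 \le k \le 16$, $$c_k \ge \frac{2(k-3)}{k(k-1)},$$ where $c_k = \sup\{\lambda_k(G)/n : G \text{ is a graph with } |V(G)| = n,\ n \ge k\}$ and $\lambda_k(G)$ denotes the $k$th largest eigenvalue (counted with multiplicity) of the adjacency matrix of $G$.
   Context: Graphs are finite, simple and undirected. For a graph $G$ on $n$ vertices, the eigenvalues of its adjacency matrix, counted with multiplicity, are denoted $\lambda_1(G) \ge \lambda_2(G) \ge \cdots \ge \lambda_n(G)$. For an integer $k \ge 1$, define $c_k = \sup\{\lambda_k(G)/n : |V(G)| = n,\ n \ge k\}$, the supremum being over all $n \ge k$ and all graphs $G$ on $n$ vertices. *)

theory Defs
  imports
    "HOL-Computational_Algebra.Fundamental_Theorem_Algebra"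
    "Jordan_Normal_Form.Char_Poly"
    "Graph_Theory.Pair_Digraph"
begin

text \<open>
  A finite simple undirected graph is a \<^locale>\<open>pair_graph\<close>: a finite vertex set with a finite,
  symmetric and irreflexive set of vertex pairs, each undirected edge being represented by its two
  orientations. The rows and columns of the adjacency matrix are indexed by the vertices in
  increasing order; the spectrum does not depend on this choice.
\<close>

definition adj_matrix :: "'a::linorder pair_pre_digraph \<Rightarrow> real mat" where
  "adj_matrix G = (let n = card (pverts G); vs = sorted_list_of_set (pverts G) in
     mat n n (\<lambda>(i, j). if (vs ! i, vs ! j) \<in> parcs G then 1 else 0))"

text \<open>
  The eigenvalues with multiplicity are the roots of the characteristic polynomial with multiplicity,
  in decreasing order. All of them are real because the matrix is symmetric: see
  \<open>length_eigenvalue_list\<close> below.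
\<close>

definition eigenvalue_list :: "'a::linorder pair_pre_digraph \<Rightarrow> real list" where
  "eigenvalue_list G = rev (sorted_list_of_multiset (proots (char_poly (adj_matrix G))))"

text \<open>The index is 1-based; the value is only meaningful for \<open>1 \<le> k \<le> card (pverts G)\<close>.\<close>

definition kth_eigenvalue :: "nat \<Rightarrow> 'a::linorder pair_pre_digraph \<Rightarrow> real" where
  "kth_eigenvalue k G = eigenvalue_list G ! (k - 1)"

text \<open>
  Every finite graph is isomorphic to one whose vertices are natural numbers. For \<open>k \<ge> 1\<close> the set is
  bounded above (\<open>bdd_above_eigenvalue_ratios\<close> below), so its real supremum is the genuine one.
\<close>

definition eigenvalue_ratios :: "nat \<Rightarrow> real set" where
  "eigenvalue_ratios k = {kth_eigenvalue k G / real (card (pverts G)) | G :: nat pair_pre_digraph.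
     pair_graph G \<and> k \<le> card (pverts G)}"

definition c_const :: "nat \<Rightarrow> real" where
  "c_const k = Sup (eigenvalue_ratios k)"

lemma adj_matrix_carrier: "adj_matrix G \<in> carrier_mat (card (pverts G)) (card (pverts G))"
  by (simp add: adj_matrix_def Let_def)

lemma adj_matrix_sym:
  assumes "pair_graph G" "i < card (pverts G)" "j < card (pverts G)"
  shows "adj_matrix G $$ (i, j) = adj_matrix G $$ (j, i)"
proof -
  interpret pair_graph G by fact
  have "sym (parcs G)" using pair_sym_arcs by (simp add: symmetric_def)
  then show ?thesis using assms(2,3) by (auto simp: adj_matrix_def Let_def dest: symD)
qed

lemma real_symmetric_eigenvalue_real:
  fixes A :: "real mat"
  assumes A: "A \<in> carrier_mat n n"
    and sym: "\<And>i j. i < n \<Longrightarrow> j < n \<Longrightarrow> A $$ (i, j) = A $$ (j, i)"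
    and ev: "eigenvalue (map_mat complex_of_real A) z"
  shows "z \<in> \<real>"
proof -
  obtain v where v: "v \<in> carrier_vec n" "v \<noteq> 0\<^sub>v n"
    and eq: "map_mat complex_of_real A *\<^sub>v v = z \<cdot>\<^sub>v v"
    using ev A by (auto simp: eigenvalue_def eigenvector_def)
  have row: "(\<Sum>j<n. of_real (A $$ (i, j)) * v $ j) = z * v $ i" if "i < n" for i
  proof -
    have "(map_mat complex_of_real A *\<^sub>v v) $ i = (z \<cdot>\<^sub>v v) $ i" using eq by simp
    then show ?thesis using that A v by (simp add: scalar_prod_def atLeast0LessThan)
  qed
  define N where "N = (\<Sum>i<n. cnj (v $ i) * v $ i)"
  have N: "N = of_real (\<Sum>i<n. (cmod (v $ i))\<^sup>2)"
    by (simp add: N_def complex_norm_square mult.commute del: of_real_power)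
  obtain l where l: "l < n" "v $ l \<noteq> 0" using v by (metis carrier_vecD eq_vecI index_zero_vec)
  have "(\<Sum>i<n. (cmod (v $ i))\<^sup>2) > 0"
    using l by (intro sum_pos2[of _ l]) auto
  then have N0: "N \<noteq> 0" using N by (metis less_irrefl of_real_eq_0_iff)
  have zN: "z * N = (\<Sum>i<n. \<Sum>j<n. cnj (v $ i) * (of_real (A $$ (i, j)) * v $ j))"
  proof -
    have "z * N = (\<Sum>i<n. cnj (v $ i) * (z * v $ i))"
      by (simp add: N_def sum_distrib_left mult_ac)
    also have "\<dots> = (\<Sum>i<n. cnj (v $ i) * (\<Sum>j<n. of_real (A $$ (i, j)) * v $ j))"
      using row by simp
    finally show ?thesis by (simp add: sum_distrib_left)
  qed
  have "cnj (z * N) = (\<Sum>i<n. \<Sum>j<n. v $ i * (of_real (A $$ (i, j)) * cnj (v $ j)))"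
    by (simp add: zN)
  also have "\<dots> = (\<Sum>j<n. \<Sum>i<n. v $ i * (of_real (A $$ (i, j)) * cnj (v $ j)))"
    by (rule sum.swap)
  also have "\<dots> = z * N"
    unfolding zN by (intro sum.cong refl) (simp add: sym mult_ac)
  finally have "cnj z * cnj N = z * N" by simp
  moreover have "cnj N = N" by (simp add: N)
  ultimately have "cnj z = z" using N0 by simp
  then show ?thesis by (simp add: Reals_cnj_iff)
qed

lemma length_eigenvalue_list:
  assumes "pair_graph G"
  shows "length (eigenvalue_list G) = card (pverts G)"
proof -
  let ?n = "card (pverts G)"
  let ?A = "adj_matrix G"
  let ?C = "map_mat complex_of_real ?A"
  have A: "?A \<in> carrier_mat ?n ?n" by (rule adj_matrix_carrier)
  then have C: "?C \<in> carrier_mat ?n ?n" by simp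
  obtain as where as: "char_poly ?C = (\<Prod>a\<leftarrow>as. [:- a, 1:])" and len: "length as = ?n"
    using char_poly_factorized[OF C] by blast
  have real: "a \<in> \<real>" if "a \<in> set as" for a
  proof (rule real_symmetric_eigenvalue_real[OF A adj_matrix_sym[OF assms]])
    have "poly (char_poly ?C) a = 0" using that as by (simp add: poly_prod_list_zero_iff)
    then show "eigenvalue ?C a" using eigenvalue_root_char_poly[OF C] by simp
  qed
  define rs where "rs = map Re as"
  have asrs: "as = map of_real rs" unfolding rs_def map_map o_def
    by (rule map_idI[symmetric]) (simp add: real)
  interpret R: map_poly_inj_idom_hom complex_of_real ..
  have hom: "map_poly complex_of_real (\<Prod>a\<leftarrow>xs. [:- a, 1:]) = (\<Prod>a\<leftarrow>map of_real xs. [:- a, 1:])"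
    for xs :: "real list"
    by (induction xs) (simp_all add: R.hom_mult del: mult_pCons_left)
  have "map_poly complex_of_real (char_poly ?A) = map_poly complex_of_real (\<Prod>a\<leftarrow>rs. [:- a, 1:])"
    unfolding hom using as asrs of_real_hom.char_poly_hom[OF A] by metis
  then have "char_poly ?A = (\<Prod>a\<leftarrow>rs. [:- a, 1:])"
    by (rule R.injectivity)
  moreover have "proots (\<Prod>a\<leftarrow>rs. [:- a, 1:]) = mset rs"
    for rs :: "real list"
  proof (induction rs)
    case (Cons r rs)
    have "(\<Prod>a\<leftarrow>rs. [:- a, 1:]) \<noteq> 0" by (auto simp: prod_list_zero_iff)
    then have "proots ([:- r, 1:] * (\<Prod>a\<leftarrow>rs. [:- a, 1:])) = {#r#} + mset rs"
      using Cons by (subst proots_mult) auto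
    then show ?case by simp
  qed simp
  ultimately have "size (proots (char_poly ?A)) = length rs" by simp
  then show ?thesis using len
    by (simp add: eigenvalue_list_def rs_def flip: size_mset)
qed

lemma eigenvalue_adj_matrix_le:
  assumes "eigenvalue (adj_matrix G) x"
  shows "x \<le> real (card (pverts G))"
proof -
  let ?n = "card (pverts G)"
  let ?A = "adj_matrix G"
  have A: "?A \<in> carrier_mat ?n ?n" by (rule adj_matrix_carrier)
  obtain v where v: "v \<in> carrier_vec ?n" "v \<noteq> 0\<^sub>v ?n" and eq: "?A *\<^sub>v v = x \<cdot>\<^sub>v v"
    using assms A by (auto simp: eigenvalue_def eigenvector_def)
  obtain l where l: "l < ?n" "v $ l \<noteq> 0" using v by (metis carrier_vecD eq_vecI index_zero_vec)
  obtain m where m: "m < ?n" "\<And>i. i < ?n \<Longrightarrow> \<bar>v $ i\<bar> \<le> \<bar>v $ m\<bar>"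
  proof -
    have "Max ((\<lambda>i. \<bar>v $ i\<bar>) ` {..<?n}) \<in> (\<lambda>i. \<bar>v $ i\<bar>) ` {..<?n}"
      using l(1) by (intro Max_in) auto
    then obtain m where "m < ?n" "Max ((\<lambda>i. \<bar>v $ i\<bar>) ` {..<?n}) = \<bar>v $ m\<bar>" by auto
    then show ?thesis by (metis that Max_ge finite_imageI finite_lessThan imageI lessThan_iff)
  qed
  have pos: "\<bar>v $ m\<bar> > 0" using m(2)[OF l(1)] l(2) by linarith
  have entry: "\<bar>?A $$ (m, j)\<bar> \<le> 1" if "j < ?n" for j
    using that m(1) by (simp add: adj_matrix_def Let_def)
  have "(?A *\<^sub>v v) $ m = (x \<cdot>\<^sub>v v) $ m" using eq by simp
  then have "x * v $ m = (\<Sum>j<?n. ?A $$ (m, j) * v $ j)"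
    using m(1) A v by (simp add: scalar_prod_def atLeast0LessThan)
  then have "\<bar>x\<bar> * \<bar>v $ m\<bar> = \<bar>\<Sum>j<?n. ?A $$ (m, j) * v $ j\<bar>" by (metis abs_mult)
  also have "\<dots> \<le> (\<Sum>j<?n. \<bar>?A $$ (m, j) * v $ j\<bar>)" by (rule sum_abs)
  also have "\<dots> \<le> (\<Sum>j<?n. \<bar>v $ m\<bar>)"
  proof (rule sum_mono)
    fix j assume "j \<in> {..<?n}"
    then have "\<bar>?A $$ (m, j)\<bar> * \<bar>v $ j\<bar> \<le> 1 * \<bar>v $ m\<bar>"
      by (intro mult_mono entry m(2)) auto
    then show "\<bar>?A $$ (m, j) * v $ j\<bar> \<le> \<bar>v $ m\<bar>" by (simp add: abs_mult)
  qed
  also have "\<dots> = real ?n * \<bar>v $ m\<bar>" by simp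
  finally show ?thesis using pos by simp
qed

lemma bdd_above_eigenvalue_ratios:
  assumes "k \<ge> 1"
  shows "bdd_above (eigenvalue_ratios k)"
proof (rule bdd_aboveI)
  fix y assume "y \<in> eigenvalue_ratios k"
  then obtain G :: "nat pair_pre_digraph" where G: "pair_graph G" "k \<le> card (pverts G)"
    and y: "y = kth_eigenvalue k G / real (card (pverts G))"
    by (auto simp: eigenvalue_ratios_def)
  let ?A = "adj_matrix G"
  have A: "?A \<in> carrier_mat (card (pverts G)) (card (pverts G))" by (rule adj_matrix_carrier)
  have "kth_eigenvalue k G \<in> set (eigenvalue_list G)"
    unfolding kth_eigenvalue_def using assms G length_eigenvalue_list[OF G(1)]
    by (intro nth_mem) simp
  then have "kth_eigenvalue k G \<in># proots (char_poly ?A)"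
    by (simp add: eigenvalue_list_def)
  moreover have "char_poly ?A \<noteq> 0"
    using degree_monic_char_poly[OF A] by auto
  ultimately have "eigenvalue ?A (kth_eigenvalue k G)"
    using eigenvalue_root_char_poly[OF A] by simp
  then show "y \<le> 1"
    using eigenvalue_adj_matrix_le y assms G by (simp add: divide_le_eq)
qed

end

theory Submission
  imports Defs
begin

text \<open>
  The triangular graph \<open>T(k)\<close>, the line graph of the complete graph on \<open>k\<close> vertices, has
  \<open>k (k - 1) / 2\<close> vertices, the simple eigenvalue \<open>2 k - 4\<close> and the eigenvalue \<open>k - 4\<close> with
  multiplicity \<open>k - 1\<close>. Replacing each vertex by a clique of size \<open>m\<close> turns an eigenvalue \<open>x\<close>
  into \<open>m (x + 1) - 1\<close>, so the \<open>k\<close>-th eigenvalue of the blow-up is at least \<open>m (k - 3) - 1\<close>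
  while it has \<open>m k (k - 1) / 2\<close> vertices. Now let \<open>m\<close> tend to infinity.
\<close>

section \<open>Characteristic polynomials and invariant column spaces\<close>

lemma char_poly_four_block_lower_left_zero:
  fixes A :: "'a :: idom mat"
  assumes A: "A \<in> carrier_mat n n" and B: "B \<in> carrier_mat n m" and D: "D \<in> carrier_mat m m"
  shows "char_poly (four_block_mat A B (0\<^sub>m m n) D) = char_poly A * char_poly D"
proof -
  have "char_poly_matrix (four_block_mat A B (0\<^sub>m m n) D) =
    four_block_mat (char_poly_matrix A) (map_mat (\<lambda>a. [:- a:]) B) (0\<^sub>m m n) (char_poly_matrix D)"
    using A B D by (intro eq_matI) (auto simp: char_poly_matrix_def)
  then show ?thesis
    using det_four_block_mat_lower_left_zero[of "char_poly_matrix A" n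
        "map_mat (\<lambda>a. [:- a:]) B" m "0\<^sub>m m n" "char_poly_matrix D"] A B D
    by (simp add: char_poly_def)
qed

text \<open>
  The matrix \<open>P = [[0, C], [B, 1 - B C]]\<close> is an involution, and conjugating \<open>diag(0, A)\<close> by it
  exposes \<open>D\<close> as a diagonal block. This avoids completing the columns of \<open>B\<close> to a basis.
\<close>

lemma char_poly_dvd_of_invariant_columns:
  fixes A :: "'a :: idom mat"
  assumes A: "A \<in> carrier_mat n n" and B: "B \<in> carrier_mat n k" and C: "C \<in> carrier_mat k n"
    and D: "D \<in> carrier_mat k k" and CB: "C * B = 1\<^sub>m k" and AB: "A * B = B * D"
  shows "char_poly D dvd char_poly (0\<^sub>m k k) * char_poly A"
proof -
  \<comment> \<open>Because \<open>C * B\<close> is the identity, \<open>B * C\<close> is idempotent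
    and fixes the columns of \<open>B\<close>; \<open>Q\<close> is the complementary projection,
    killing those columns.\<close>
  define Q where "Q = 1\<^sub>m n - B * C"
  have BC: "B * C \<in> carrier_mat n n" using B C by simp
  then have Q: "Q \<in> carrier_mat n n" unfolding Q_def by (rule minus_carrier_mat)
  have CBC: "C * (B * C) = C"
    using B C by (simp flip: assoc_mult_mat[OF C B C] add: CB)
  have BCB: "B * C * B = B"
    using B C by (simp add: assoc_mult_mat[OF B C B] CB)
  have CQ: "C * Q = 0\<^sub>m k n"
    unfolding Q_def using B C BC by (simp add: mult_minus_distrib_mat[OF C _ BC] CBC)
  have QB: "Q * B = 0\<^sub>m n k"
    unfolding Q_def using B C BC by (simp add: minus_mult_distrib_mat[OF _ BC B] BCB)
  have QQ: "Q * Q = Q"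
  proof -
    have "(1\<^sub>m n - B * C) * Q = 1\<^sub>m n * Q - (B * C) * Q"
      by (rule minus_mult_distrib_mat[OF _ BC Q]) simp
    also have "(B * C) * Q = 0\<^sub>m n n"
      using B by (simp add: assoc_mult_mat[OF B C Q] CQ)
    finally have "(1\<^sub>m n - B * C) * Q = Q" using Q by auto
    then show ?thesis by (simp add: Q_def)
  qed
  have BCQ: "B * C + Q = 1\<^sub>m n"
    unfolding Q_def using B C by (intro eq_matI) auto
  define P where "P = four_block_mat (0\<^sub>m k k) C B Q"
  have P: "P \<in> carrier_mat (k + n) (k + n)" unfolding P_def using Q by simp
  have PP: "P * P = 1\<^sub>m (k + n)"
    unfolding P_def
    apply (subst mult_four_block_mat[OF _ C B Q _ C B Q])
    using B C Q by (simp_all add: CB CQ QB QQ BCQ four_block_one_mat)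
  \<comment> \<open>The zero block pads \<open>A\<close> to the size of \<open>P\<close>; it is the
    source of the factor \<open>char_poly (0\<^sub>m k k)\<close> in the conclusion.\<close>
  define A0 where "A0 = four_block_mat (0\<^sub>m k k) (0\<^sub>m k n) (0\<^sub>m n k) A"
  have A0: "A0 \<in> carrier_mat (k + n) (k + n)" unfolding A0_def using A by simp
  have CBD: "C * (B * D) = D" using B C D by (simp flip: assoc_mult_mat[OF C B D] add: CB)
  have QBD: "Q * (B * D) = 0\<^sub>m n k" using Q B D by (simp flip: assoc_mult_mat[OF Q B D] add: QB)
  have CA: "C * A \<in> carrier_mat k n" and QA: "Q * A \<in> carrier_mat n n" using A C Q by auto
  have PA: "P * A0 = four_block_mat (0\<^sub>m k k) (C * A) (0\<^sub>m n k) (Q * A)"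
    unfolding P_def A0_def
    apply (subst mult_four_block_mat[OF _ C B Q _ _ _ A])
    using A B C Q CA QA by auto
  \<comment> \<open>Invariance does the work: \<open>A * B = B * D\<close> turns the left blocks
    \<open>C * A * B\<close> and \<open>Q * A * B\<close> into \<open>D\<close> and zero.\<close>
  have "P * A0 * P = four_block_mat D (C * A * Q) (0\<^sub>m n k) (Q * A * Q)"
    unfolding PA unfolding P_def
    apply (subst mult_four_block_mat[OF _ CA _ QA _ C B Q])
    using A B C D Q CA QA
    by (auto simp: assoc_mult_mat[OF C A B] assoc_mult_mat[OF Q A B] AB CBD QBD)
  then have "similar_mat (four_block_mat D (C * A * Q) (0\<^sub>m n k) (Q * A * Q)) A0"
    using P A0 PP D Q by (intro similar_matI[of _ _ P P "k + n"]) auto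
  then have "char_poly (four_block_mat D (C * A * Q) (0\<^sub>m n k) (Q * A * Q)) = char_poly A0"
    by (rule char_poly_similar)
  moreover have "char_poly (four_block_mat D (C * A * Q) (0\<^sub>m n k) (Q * A * Q)) =
      char_poly D * char_poly (Q * A * Q)"
    using CA QA Q by (intro char_poly_four_block_lower_left_zero[OF D]) auto
  moreover have "char_poly A0 = char_poly (0\<^sub>m k k) * char_poly A"
    unfolding A0_def by (intro char_poly_four_block_lower_left_zero A) auto
  ultimately show ?thesis by (metis dvd_triv_left)
qed

section \<open>Counting large eigenvalues with multiplicity\<close>

lemma proots_char_poly_upper_triangular:
  fixes A :: "'a :: idom mat"
  assumes "A \<in> carrier_mat n n" "upper_triangular A"
  shows "proots (char_poly A) = mset (diag_mat A)"
proof -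
  have "proots (\<Prod>a\<leftarrow>as. [:- a, 1:]) = mset as" for as :: "'a list"
  proof (induction as)
    case (Cons a as)
    have "(\<Prod>a\<leftarrow>as. [:- a, 1:]) \<noteq> 0" by (auto simp: prod_list_zero_iff)
    then have "proots ([:- a, 1:] * (\<Prod>a\<leftarrow>as. [:- a, 1:])) = {#a#} + mset as"
      using Cons by (subst proots_mult) auto
    then show ?case by simp
  qed simp
  then show ?thesis by (simp add: char_poly_upper_triangular[OF assms])
qed

lemma char_poly_nonzero:
  fixes A :: "'a :: comm_ring_1 mat"
  assumes "A \<in> carrier_mat n n"
  shows "char_poly A \<noteq> 0"
  using degree_monic_char_poly[OF assms] by auto

text \<open>The dual family \<open>w\<close> supplies a left inverse of the matrix with columns
  \<open>v\<close>. Independence is thus certified by explicit sums, and multiplicities come from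
  divisibility of characteristic polynomials rather than from dimensions of eigenspaces.\<close>

lemma count_large_eigenvalues:
  fixes A :: "real mat" and v w :: "nat \<Rightarrow> nat \<Rightarrow> real" and d :: "nat \<Rightarrow> real"
  assumes A: "A \<in> carrier_mat n n"
    and dual: "\<And>a b. a < k \<Longrightarrow> b < k \<Longrightarrow> (\<Sum>i<n. w a i * v b i) = (if a = b then 1 else 0)"
    and eig: "\<And>a i. a < k \<Longrightarrow> i < n \<Longrightarrow> (\<Sum>j<n. A $$ (i, j) * v a j) = d a * v a i"
    and d: "\<And>a. a < k \<Longrightarrow> t \<le> d a" and t: "0 < t"
  shows "k \<le> size {#x \<in># proots (char_poly A). t \<le> x#}"
proof -
  define B where "B = mat n k (\<lambda>(i, a). v a i)"
  define C where "C = mat k n (\<lambda>(a, i). w a i)"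
  define D where "D = mat k k (\<lambda>(a, b). if a = b then d a else 0)"
  have carr: "B \<in> carrier_mat n k" "C \<in> carrier_mat k n" "D \<in> carrier_mat k k"
    by (auto simp: B_def C_def D_def)
  have "C * B = 1\<^sub>m k"
    by (rule eq_matI) (auto simp: B_def C_def scalar_prod_def atLeast0LessThan dual)
  moreover have "A * B = B * D"
  proof (rule eq_matI)
    fix i a assume "i < dim_row (B * D)" "a < dim_col (B * D)"
    then have ia: "i < n" "a < k" using carr by auto
    have "(A * B) $$ (i, a) = (\<Sum>j<n. A $$ (i, j) * v a j)"
      using A ia by (simp add: B_def scalar_prod_def atLeast0LessThan)
    also have "\<dots> = (\<Sum>b<k. v b i * (if b = a then d b else 0))"
      using ia eig by (simp add: if_distrib sum.delta cong: if_cong)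
    also have "\<dots> = (B * D) $$ (i, a)"
      using ia by (simp add: B_def D_def scalar_prod_def atLeast0LessThan)
    finally show "(A * B) $$ (i, a) = (B * D) $$ (i, a)" .
  qed (use A carr in auto)
  ultimately have "char_poly D dvd char_poly (0\<^sub>m k k) * char_poly A"
    by (intro char_poly_dvd_of_invariant_columns[OF A carr])
  then obtain q where q: "char_poly (0\<^sub>m k k) * char_poly A = char_poly D * q" by auto
  have ne: "char_poly (0\<^sub>m k k :: real mat) \<noteq> 0" "char_poly A \<noteq> 0"
    using char_poly_nonzero[OF A] char_poly_nonzero[of "0\<^sub>m k k :: real mat" k] by auto
  then have ne': "char_poly D \<noteq> 0" "q \<noteq> 0" using q by auto
  have "proots (char_poly (0\<^sub>m k k)) + proots (char_poly A) = proots (char_poly D) + proots q"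
    using q proots_mult[OF ne] proots_mult[OF ne'] by simp
  then have "filter_mset ((\<le>) t) (proots (char_poly (0\<^sub>m k k))) +
      filter_mset ((\<le>) t) (proots (char_poly A)) =
      filter_mset ((\<le>) t) (proots (char_poly D)) + filter_mset ((\<le>) t) (proots q)"
    by (metis filter_union_mset)
  \<comment> \<open>The padding contributes only roots 0, which the positive threshold
    \<open>t\<close> excludes from the count.\<close>
  moreover have "filter_mset ((\<le>) t) (proots (char_poly (0\<^sub>m k k))) = {#}"
  proof -
    have "proots (char_poly (0\<^sub>m k k :: real mat)) = mset (diag_mat (0\<^sub>m k k))"
      by (rule proots_char_poly_upper_triangular[of _ k]) auto
    then show ?thesis using t by (auto simp: diag_mat_def filter_mset_eq_conv)
  qed
  moreover have "size (filter_mset ((\<le>) t) (proots (char_poly D))) = k"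
  proof -
    have p: "proots (char_poly D) = mset (diag_mat D)"
      by (rule proots_char_poly_upper_triangular[OF carr(3)]) (auto simp: D_def)
    have "filter_mset ((\<le>) t) (mset (diag_mat D)) = mset (diag_mat D)"
      using d by (auto simp: diag_mat_def D_def filter_mset_eq_conv)
    then show ?thesis unfolding p by (simp add: diag_mat_def D_def)
  qed
  ultimately have "size (filter_mset ((\<le>) t) (proots (char_poly A))) =
      k + size (filter_mset ((\<le>) t) (proots q))"
    by (metis add_0 size_union)
  then show ?thesis by simp
qed

lemma nth_rev_sorted_list_ge:
  fixes M :: "'a :: linorder multiset"
  assumes "1 \<le> k" and k: "k \<le> size {#x \<in># M. t \<le> x#}"
  shows "t \<le> rev (sorted_list_of_multiset M) ! (k - 1)"
proof (rule ccontr)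
  define ys where "ys = rev (sorted_list_of_multiset M)"
  assume "\<not> t \<le> rev (sorted_list_of_multiset M) ! (k - 1)"
  then have less: "ys ! (k - 1) < t" by (simp add: ys_def)
  have mset: "mset ys = M" by (simp add: ys_def)
  have "sorted (rev ys)" by (simp add: ys_def)
  then have desc: "ys ! j \<le> ys ! i" if "i \<le> j" "j < length ys" for i j
    using that by (rule sorted_rev_nth_mono)
  have "size {#x \<in># M. t \<le> x#} = length (filter ((\<le>) t) ys)"
    unfolding mset[symmetric] by (simp flip: mset_filter)
  also have "\<dots> = card {i. i < length ys \<and> t \<le> ys ! i}"
    by (rule length_filter_conv_card)
  \<comment> \<open>In a decreasing list whose entry at index \<open>k - 1\<close> is below
    \<open>t\<close>, every entry reaching \<open>t\<close> lies strictly earlier.\<close>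
  also have "\<dots> \<le> card {..<k - 1}"
  proof (rule card_mono)
    show "{i. i < length ys \<and> t \<le> ys ! i} \<subseteq> {..<k - 1}"
    proof
      fix i assume "i \<in> {i. i < length ys \<and> t \<le> ys ! i}"
      then show "i \<in> {..<k - 1}" using desc[of "k - 1" i] less by (cases "k - 1 \<le> i") auto
    qed
  qed simp
  finally show False using assms by simp
qed

section \<open>Incidence counts for the edges of a complete graph\<close>

definition edges_complete :: "nat \<Rightarrow> nat set set" where
  "edges_complete k = {e. e \<subseteq> {..<k} \<and> card e = 2}"

lemma finite_edges_complete [simp]: "finite (edges_complete k)"
  by (rule finite_subset[of _ "Pow {..<k}"]) (auto simp: edges_complete_def)

lemma card_edges_complete: "card (edges_complete k) = k choose 2"
  using n_subsets[of "{..<k}" 2] by (simp add: edges_complete_def)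

lemma card_edges_containing:
  assumes "a < k" "b < k"
  shows "card {e \<in> edges_complete k. a \<in> e \<and> b \<in> e} = (if a = b then k - 1 else 1)"
proof (cases "a = b")
  case True
  have "{e \<in> edges_complete k. a \<in> e} = (\<lambda>c. {a, c}) ` ({..<k} - {a})"
    using assms by (auto simp: edges_complete_def card_2_iff)
  moreover have "inj_on (\<lambda>c. {a, c}) ({..<k} - {a})"
    by (auto simp: inj_on_def doubleton_eq_iff)
  ultimately show ?thesis using True assms by (simp add: card_image)
next
  case False
  then have "{e \<in> edges_complete k. a \<in> e \<and> b \<in> e} = {{a, b}}"
    using assms by (auto simp: edges_complete_def card_2_iff)
  then show ?thesis using False by simp
qed

text \<open>In matrix form this is N N^T = J + (k - 2) I, where N is the vertex-edge incidence
  matrix and J the all-ones matrix.\<close>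

lemma sum_edges_containing:
  assumes "a < k" "b < k"
  shows "(\<Sum>e\<in>edges_complete k. of_bool (a \<in> e) * of_bool (b \<in> e) :: real) =
    1 + (real k - 2) * of_bool (a = b)"
proof -
  have "(\<Sum>e\<in>edges_complete k. of_bool (a \<in> e) * of_bool (b \<in> e) :: real) =
      real (card {e \<in> edges_complete k. a \<in> e \<and> b \<in> e})"
    by (simp flip: of_bool_conj add: Int_def)
  also have "\<dots> = 1 + (real k - 2) * of_bool (a = b)"
    using assms by (simp add: card_edges_containing of_nat_diff)
  finally show ?thesis .
qed

lemma sum_degree_edges:
  assumes "a < k"
  shows "(\<Sum>e\<in>edges_complete k. of_bool (a \<in> e) :: real) = real k - 1"
  using sum_edges_containing[OF assms assms] by (simp flip: of_bool_conj)

text \<open>Distinct edges share at most one vertex, so counting common vertices already gives the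
  indicator; an edge shares two with itself, hence the correction. The triangular graph with loops
  therefore has matrix N^T N - I.\<close>

lemma of_bool_edges_meet:
  assumes "e \<in> edges_complete k" "f \<in> edges_complete k"
  shows "of_bool (e \<inter> f \<noteq> {}) = (\<Sum>a\<in>e. of_bool (a \<in> f)) - (of_bool (e = f) :: real)"
proof -
  obtain a b where "e = {a, b}" "a \<noteq> b" using assms by (auto simp: edges_complete_def card_2_iff)
  moreover obtain c d where "f = {c, d}" "c \<noteq> d"
    using assms by (auto simp: edges_complete_def card_2_iff)
  ultimately show ?thesis by auto
qed

lemma sum_meeting_edges:
  fixes g :: "nat set \<Rightarrow> real"
  assumes e: "e \<in> edges_complete k"
  shows "(\<Sum>f\<in>edges_complete k. of_bool (e \<inter> f \<noteq> {}) * g f) =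
    (\<Sum>a\<in>e. \<Sum>f\<in>edges_complete k. of_bool (a \<in> f) * g f) - g e"
proof -
  have "(\<Sum>f\<in>edges_complete k. of_bool (e \<inter> f \<noteq> {}) * g f) =
      (\<Sum>f\<in>edges_complete k. (\<Sum>a\<in>e. of_bool (a \<in> f) * g f) - of_bool (e = f) * g f)"
    by (intro sum.cong refl) (simp add: of_bool_edges_meet[OF e] left_diff_distrib sum_distrib_right)
  also have "\<dots> = (\<Sum>f\<in>edges_complete k. \<Sum>a\<in>e. of_bool (a \<in> f) * g f) - g e"
    using e by (simp add: sum_subtractf of_bool_def if_distrib[of "\<lambda>x. x * _"] sum.delta cong: if_cong)
  finally show ?thesis by (subst sum.swap)
qed

lemma sum_meeting_edges_one:
  assumes e: "e \<in> edges_complete k"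
  shows "(\<Sum>f\<in>edges_complete k. of_bool (e \<inter> f \<noteq> {}) :: real) = 2 * real k - 3"
proof -
  have "e \<subseteq> {..<k}" "card e = 2" using e by (auto simp: edges_complete_def)
  then have "(\<Sum>a\<in>e. \<Sum>f\<in>edges_complete k. of_bool (a \<in> f) :: real) = (\<Sum>a\<in>e. real k - 1)"
    by (intro sum.cong refl sum_degree_edges) auto
  then show ?thesis using sum_meeting_edges[OF e, of "\<lambda>_. 1"] \<open>card e = 2\<close> by simp
qed

text \<open>The summand 2 is independent of \<open>b\<close>, so it cancels in the difference of two
  star indicators, leaving an eigenvector for \<open>k - 3\<close>.\<close>

lemma sum_meeting_edges_containing:
  assumes e: "e \<in> edges_complete k" and b: "b < k"
  shows "(\<Sum>f\<in>edges_complete k. of_bool (e \<inter> f \<noteq> {}) * of_bool (b \<in> f) :: real) =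
    2 + (real k - 3) * of_bool (b \<in> e)"
proof -
  have ek: "e \<subseteq> {..<k}" "card e = 2" "finite e"
    using e by (auto simp: edges_complete_def intro: card_ge_0_finite)
  then have "(\<Sum>a\<in>e. \<Sum>f\<in>edges_complete k. of_bool (a \<in> f) * of_bool (b \<in> f) :: real) =
      (\<Sum>a\<in>e. 1 + (real k - 2) * of_bool (a = b))"
    by (intro sum.cong refl sum_edges_containing b) auto
  also have "\<dots> = 2 + (real k - 2) * of_bool (b \<in> e)"
    using ek by (simp add: sum.distrib flip: sum_distrib_left)
  finally show ?thesis
    using sum_meeting_edges[OF e, of "\<lambda>f. of_bool (b \<in> f)"] by (simp add: algebra_simps)
qed


section \<open>Spectrum of the blown-up triangular graphs\<close>

text \<open>
  For \<open>\<phi>\<close> running \<open>m\<close> times through the edges of a complete graph this is the closed \<open>m\<close>-fold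
  blow-up of a triangular graph: copies of the same edge are adjacent.
\<close>

definition intersection_graph :: "nat \<Rightarrow> (nat \<Rightarrow> nat set) \<Rightarrow> nat pair_pre_digraph" where
  "intersection_graph n \<phi> =
    \<lparr>pverts = {..<n}, parcs = {(i, j). i < n \<and> j < n \<and> i \<noteq> j \<and> \<phi> i \<inter> \<phi> j \<noteq> {}}\<rparr>"

lemma pair_graph_intersection_graph: "pair_graph (intersection_graph n \<phi>)"
proof
  show "finite (parcs (intersection_graph n \<phi>))"
    by (rule finite_subset[of _ "{..<n} \<times> {..<n}"]) (auto simp: intersection_graph_def)
  show "symmetric (with_proj (intersection_graph n \<phi>))"
    by (auto simp: symmetric_def sym_def arcs_ends_def arc_to_ends_def with_proj_def
        intersection_graph_def image_iff)
qed (auto simp: intersection_graph_def)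

lemma adj_matrix_intersection_graph:
  assumes "i < n" "j < n"
  shows "adj_matrix (intersection_graph n \<phi>) $$ (i, j) =
    of_bool (\<phi> i \<inter> \<phi> j \<noteq> {} \<and> i \<noteq> j)"
  using assms by (auto simp: adj_matrix_def intersection_graph_def lessThan_atLeast0 Let_def)

text \<open>The assumption \<open>uniform\<close> says that \<phi> takes each edge exactly
  \<open>m\<close> times, in the form that moves sums over vertices to sums over edges.\<close>

lemma kth_eigenvalue_blowup_ge:
  assumes k: "5 \<le> k" and m: "1 \<le> m"
    and \<phi>: "\<And>i. i < n \<Longrightarrow> \<phi> i \<in> edges_complete k"
    and uniform: "\<And>g :: nat set \<Rightarrow> real. (\<Sum>i<n. g (\<phi> i)) = real m * (\<Sum>e\<in>edges_complete k. g e)"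
  shows "kth_eigenvalue k (intersection_graph n \<phi>) \<ge> real m * (real k - 3) - 1"
proof -
  define A where "A = adj_matrix (intersection_graph n \<phi>)"
  have A: "A \<in> carrier_mat n n"
    using adj_matrix_carrier[of "intersection_graph n \<phi>"] by (simp add: A_def intersection_graph_def)
  \<comment> \<open>On functions constant on the copies of each edge, the graph acts as
    \<open>m\<close> times the triangular graph with loops, minus the identity because a vertex is
    not adjacent to itself.\<close>
  have A_sum: "(\<Sum>j<n. A $$ (i, j) * g (\<phi> j)) =
      real m * (\<Sum>f\<in>edges_complete k. of_bool (\<phi> i \<inter> f \<noteq> {}) * g f) - g (\<phi> i)"
    if i: "i < n" for i and g :: "nat set \<Rightarrow> real"
  proof -
    have ne: "\<phi> i \<noteq> {}" using \<phi>[OF i] by (auto simp: edges_complete_def)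
    have "(\<Sum>j<n. A $$ (i, j) * g (\<phi> j)) =
        (\<Sum>j<n. of_bool (\<phi> i \<inter> \<phi> j \<noteq> {}) * g (\<phi> j) - (if i = j then g (\<phi> j) else 0))"
      using i ne by (intro sum.cong refl) (auto simp: A_def adj_matrix_intersection_graph)
    also have "\<dots> = (\<Sum>j<n. of_bool (\<phi> i \<inter> \<phi> j \<noteq> {}) * g (\<phi> j)) - g (\<phi> i)"
      using i by (simp add: sum_subtractf)
    finally show ?thesis by (simp add: uniform[of "\<lambda>f. of_bool (\<phi> i \<inter> f \<noteq> {}) * g f"])
  qed
  \<comment> \<open>With \<open>x\<^sub>a\<close> the indicator of the edges at \<open>a\<close>, the eigenvectors are the constant one and the
    differences \<open>x\<^sub>a - x\<^sub>0\<close>; \<open>w\<close> is a family dual to them.\<close>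
  define v :: "nat \<Rightarrow> nat set \<Rightarrow> real" where
    "v a e = (if a = 0 then 1 else of_bool (a \<in> e) - of_bool (0 \<in> e))" for a e
  define w :: "nat \<Rightarrow> nat set \<Rightarrow> real" where
    "w a e = (if a = 0 then 2 / (real m * real k * (real k - 1))
      else (of_bool (a \<in> e) - 2 / real k) / (real m * (real k - 2)))" for a e
  define d where "d a = (if a = 0 then real m * (2 * real k - 3) - 1 else real m * (real k - 3) - 1)"
    for a :: nat
  have card_E: "real (card (edges_complete k)) = real k * (real k - 1) / 2"
    using k by (simp add: card_edges_complete choose_two real_of_nat_div of_nat_diff)
  have k0: "0 < k" using k by simp
  have "k \<le> size {#x \<in># proots (char_poly A). real m * (real k - 3) - 1 \<le> x#}"
  proof (rule count_large_eigenvalues[where v = "\<lambda>a i. v a (\<phi> i)" and w = "\<lambda>a i. w a (\<phi> i)" and d = d])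
    fix a b assume a: "a < k" and b: "b < k"
    have sv: "(\<Sum>e\<in>edges_complete k. v b e) = (if b = 0 then real k * (real k - 1) / 2 else 0)"
      by (simp add: v_def sum_subtractf sum_degree_edges b k0 card_E del: sum_of_bool_eq)
    \<comment> \<open>For nonzero \<open>b\<close>, subtracting the star at 0 cancels the all-ones
      part of the Gram matrix N N^T, so only \<open>a = b\<close> survives.\<close>
    have sav: "(\<Sum>e\<in>edges_complete k. of_bool (a \<in> e) * v b e) =
        (if b = 0 then real k - 1 else if a = b then real k - 2 else 0)" if "a \<noteq> 0"
      using that
      by (simp add: v_def sum_subtractf sum_degree_edges sum_edges_containing a b k0 right_diff_distrib
          del: sum_of_bool_eq sum_of_bool_mult_eq sum_mult_of_bool_eq)
    have "(\<Sum>e\<in>edges_complete k. w a e * v b e) = (if a = b then 1 else 0) / real m"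
    proof (cases "a = 0")
      case True
      have "(\<Sum>e\<in>edges_complete k. w a e * v b e) =
          2 / (real m * real k * (real k - 1)) * (\<Sum>e\<in>edges_complete k. v b e)"
        by (simp add: True w_def sum_distrib_left)
      also have "\<dots> = (if a = b then 1 else 0) / real m"
        using True k m unfolding sv by (auto simp: field_simps)
      finally show ?thesis .
    next
      case False
      \<comment> \<open>The number \<open>2 / real k\<close> is the average of a star indicator over
        all edges. Centring by it gives orthogonality to the constant vector, the case
        \<open>b = 0\<close>.\<close>
      have "(\<Sum>e\<in>edges_complete k. w a e * v b e) =
          ((\<Sum>e\<in>edges_complete k. of_bool (a \<in> e) * v b e)
            - 2 / real k * (\<Sum>e\<in>edges_complete k. v b e)) / (real m * (real k - 2))"
        unfolding sum_distrib_left sum_subtractf[symmetric] sum_divide_distrib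
        by (intro sum.cong refl) (simp add: False w_def field_simps)
      also have "\<dots> = (if a = b then 1 else 0) / real m"
        using False k m unfolding sv sav[OF False] by (auto simp: field_simps)
      finally show ?thesis .
    qed
    then show "(\<Sum>i<n. w a (\<phi> i) * v b (\<phi> i)) = (if a = b then 1 else 0)"
      using m by (simp add: uniform[of "\<lambda>e. w a e * v b e"])
  next
    fix a i assume a: "a < k" and i: "i < n"
    have "(\<Sum>f\<in>edges_complete k. of_bool (\<phi> i \<inter> f \<noteq> {}) * v a f) =
        (if a = 0 then 2 * real k - 3 else (real k - 3) * v a (\<phi> i))"
      using \<phi>[OF i] a k0
      by (cases "a = 0") (simp_all add: v_def right_diff_distrib sum_subtractf
          sum_meeting_edges_one sum_meeting_edges_containing
          del: sum_of_bool_eq sum_of_bool_mult_eq sum_mult_of_bool_eq)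
    then show "(\<Sum>j<n. A $$ (i, j) * v a (\<phi> j)) = d a * v a (\<phi> i)"
      unfolding A_sum[OF i] by (auto simp: v_def d_def algebra_simps)
  next
    fix a show "real m * (real k - 3) - 1 \<le> d a"
      using mult_left_mono[of "real k - 3" "2 * real k - 3" "real m"] by (simp add: d_def)
  next
    \<comment> \<open>The threshold has to be positive for \<open>count_large_eigenvalues\<close>;
      \<open>5 \<le> k\<close> ensures this even when \<open>m = 1\<close>.\<close>
    have "1 * 2 \<le> real m * (real k - 3)" using k m by (intro mult_mono) auto
    then show "0 < real m * (real k - 3) - 1" by simp
  qed (rule A)
  then show ?thesis
    unfolding kth_eigenvalue_def eigenvalue_list_def A_def using k
    by (intro nth_rev_sorted_list_ge) auto
qed

text \<open>An enumeration of the edges is repeated cyclically: each of the \<open>m\<close> blocks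
  of \<open>k choose 2\<close> consecutive indices meets every edge once.\<close>

lemma uniform_edge_map_exists:
  assumes "2 \<le> k"
  obtains \<phi> where "\<And>i. \<phi> i \<in> edges_complete k"
    "\<And>g :: nat set \<Rightarrow> real. (\<Sum>i<m * (k choose 2). g (\<phi> i)) = real m * (\<Sum>e\<in>edges_complete k. g e)"
proof -
  let ?N = "k choose 2"
  have N: "0 < ?N" using assms by simp
  obtain h where h: "bij_betw h {0..<?N} (edges_complete k)"
    using ex_bij_betw_nat_finite[OF finite_edges_complete] card_edges_complete by metis
  show thesis
  proof
    show "h (i mod ?N) \<in> edges_complete k" for i
      using bij_betwE[OF h] N by simp
    show "(\<Sum>i<m * ?N. g (h (i mod ?N))) = real m * (\<Sum>e\<in>edges_complete k. g e)"
      for g :: "nat set \<Rightarrow> real"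
    proof -
      have "(\<Sum>i\<in>{q * ?N..<q * ?N + ?N}. g (h (i mod ?N))) = (\<Sum>i\<in>{0..<?N}. g (h i))" for q
        using sum.shift_bounds_nat_ivl[of "\<lambda>i. g (h (i mod ?N))" 0 "q * ?N" ?N]
        by (simp add: add.commute)
      then have "(\<Sum>i<m * ?N. g (h (i mod ?N))) = real m * (\<Sum>i\<in>{0..<?N}. g (h i))"
        by (simp flip: sum.nat_group)
      then show ?thesis by (simp add: sum.reindex_bij_betw[OF h])
    qed
  qed
qed

section \<open>Passage to the supremum and to large blow-up factors\<close>

lemma c_const_ge_blowup:
  assumes k: "5 \<le> k" and m: "1 \<le> m"
  shows "2 * (real k - 3) / (real k * (real k - 1)) - 1 / real m \<le> c_const k"
proof -
  define n where "n = m * (k choose 2)"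
  obtain \<phi> where \<phi>: "\<And>i. \<phi> i \<in> edges_complete k"
    "\<And>g :: nat set \<Rightarrow> real. (\<Sum>i<n. g (\<phi> i)) = real m * (\<Sum>e\<in>edges_complete k. g e)"
    using uniform_edge_map_exists[of k m] k unfolding n_def by auto
  let ?G = "intersection_graph n \<phi>"
  have n_eq: "real n = real m * (real k * (real k - 1) / 2)"
    using k by (simp add: n_def choose_two real_of_nat_div of_nat_diff)
  \<comment> \<open>Two size bounds are prepared: \<open>k \<le> n\<close> admits \<open>?G\<close>
    to \<open>eigenvalue_ratios k\<close>, and \<open>m \<le> n\<close> lets the exact loss 1/n be
    weakened to 1/m.\<close>
  have "real k * 2 \<le> real k * (real k - 1)" using k by (intro mult_left_mono) auto
  then have k_le: "real k \<le> real k * (real k - 1) / 2" by simp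
  have n_ge: "real k * (real k - 1) / 2 \<le> real n"
    using mult_right_mono[of 1 "real m" "real k * (real k - 1) / 2"] k_le m unfolding n_eq by linarith
  with k_le have kn: "real k \<le> real n" by linarith
  have "1 \<le> real k * (real k - 1) / 2" using k_le k by linarith
  then have "real m * 1 \<le> real n"
    unfolding n_eq by (rule mult_left_mono) simp
  then have mn: "real m \<le> real n" by simp
  have card: "card (pverts ?G) = n" by (simp add: intersection_graph_def)
  have "2 * (real k - 3) / (real k * (real k - 1)) - 1 / real m \<le>
      2 * (real k - 3) / (real k * (real k - 1)) - 1 / real n"
    using m mn by (simp add: frac_le)
  also have "\<dots> = (real m * (real k - 3) - 1) / real n"
  proof -
    have *: "2 * x / c - 1 / (real m * (c / 2)) = (real m * x - 1) / (real m * (c / 2))"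
      if "c \<noteq> 0" for x c :: real
      using that m by (simp add: field_simps)
    show ?thesis unfolding n_eq by (rule *) (use k in simp)
  qed
  also have "\<dots> \<le> kth_eigenvalue k ?G / real n"
    using kth_eigenvalue_blowup_ge[OF k m \<phi>] by (intro divide_right_mono) auto
  also have "\<dots> \<le> c_const k"
    unfolding c_const_def
  proof (rule cSup_upper)
    show "kth_eigenvalue k ?G / real n \<in> eigenvalue_ratios k"
      unfolding eigenvalue_ratios_def using card kn pair_graph_intersection_graph
      by (intro CollectI exI[of _ ?G]) simp
    show "bdd_above (eigenvalue_ratios k)" using k by (intro bdd_above_eigenvalue_ratios) simp
  qed
  finally show ?thesis .
qed

theorem theorem3:
  fixes k :: nat
  assumes "6 \<le> k" and "k \<le> 16"
  shows "c_const k \<ge> 2 * (real k - 3) / (real k * (real k - 1))"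
proof (rule field_le_epsilon)
  fix \<epsilon> :: real assume "0 < \<epsilon>"
  then obtain m where m: "1 \<le> m" "1 / real m < \<epsilon>"
    using nat_approx_posE[of \<epsilon>] by (metis Suc_le_mono One_nat_def le0)
  show "2 * (real k - 3) / (real k * (real k - 1)) \<le> c_const k + \<epsilon>"
    using c_const_ge_blowup[of k m] m assms by simp
qed

end
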